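(* Let $b,d\in\mathbb N$, $k,\ell,t\in\mathbb N_+$ with $b+\ell\ge3$, $k\ge d+3$ and $d+1<t\le k-1$; set $n=b(k+1)+\ell k+d$ and $a=b+(b+\ell)(k-t)+t-1$. Then $a\ge t+2$, and with $\kappa=b+\ell$ the partitions $$p=\big((\kappa+1)^{[d+1]},\kappa^{[t-d-1]},1^{[a-t]}\big),\qquad q=\big(\kappa+d,\kappa^{[k-1]},b\big)$$ satisfy $p\nearrow q$ but not $p\swarrow q$, where $p\in\mathcal J(\mathcal L_n)$ is of type D and $q\in\mathcal M(\mathcal L_n)$ is of type I if $b=d=0$, of type II if $d=0$ and $b\ge1$, and of type IV if $d\ge1$.
   Context: $\mathbb N=\{0,1,2,\dots\}$, $\mathbb N_+=\mathbb N\setminus\{0\}$. A partition of $n\in\mathbb N$ is a tuple $(a_1,\dots,a_n)$ of natural numbers with $a_1\ge\dots\ge a_n\ge 0$ and $\sum a_i=n$; trailing zeros may be omitted or added. $x^{[s]}$ denotes $s$ consecutive entries equal to $x$ (no entry if $s=0$). $\mathcal L_n$ is the finite lattice of all partitions of $n$ under the dominance order: $a\le b$ iff $\sum_{i=1}^j a_i\le\sum_{i=1}^j b_i$ for all $1\le j\le n$. $\mathcal J(\mathcal L_n)$ is the set of (completely) join-irreducible elements (not the least element, and $x=y\vee z$ implies $x=y$ or $x=z$); $\mathcal M(\mathcal L_n)$ is the set of (completely) meet-irreducible elements (not the greatest element, and $x=y\wedge z$ implies $x=y$ or $x=z$). Arrow relations of the standard context $(\mathcal J(\mathcal L_n),\mathcal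 M(\mathcal L_n),\le)$: for $g\in\mathcal J(\mathcal L_n)$ and $m\in\mathcal M(\mathcal L_n)$ put $g'=\{y\in\mathcal M(\mathcal L_n): g\le y\}$ and $m'=\{y\in\mathcal J(\mathcal L_n): y\le m\}$. Then $g\swarrow m$ iff $g\nleq m$ and for all $h\in\mathcal J(\mathcal L_n)$ with $g'\subsetneq h'$ we have $h\le m$; and $g\nearrow m$ iff $g\nleq m$ and for all $y\in\mathcal M(\mathcal L_n)$ with $m'\subsetneq y'$ we have $g\le y$. Types of partitions of $n$: type D (in $\mathcal J(\mathcal L_n)$): $((k+1)^{[b]},k^{[\ell]},1^{[d]})$ with $b\in\mathbb N$, $\ell,d\in\mathbb N_+$, $k\ge3$, $b+\ell\ge2$. In $\mathcal M(\mathcal L_n)$: type I: $(t^{[c]})$ with $t\ge1$, $c\ge2$; type II: $(t^{[c]},r)$ with $t>r\ge1$, $c\ge1$; type IV: $(a,t^{[c]},r)$ with $a>t>r\ge0$ and $t,c\ge2$. *)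

theory Defs
  imports "HOL-Algebra.Complete_Lattice"
begin

definition partitions :: "nat \<Rightarrow> nat list set" where
  "partitions n = {a. length a = n \<and> sorted_wrt (\<ge>) a \<and> sum_list a = n}"

definition dominance :: "nat \<Rightarrow> nat list \<Rightarrow> nat list \<Rightarrow> bool" where
  "dominance n a b \<longleftrightarrow> (\<forall>j\<in>{1..n}. sum_list (take j a) \<le> sum_list (take j b))"

definition partition_lattice :: "nat \<Rightarrow> nat list gorder" where
  "partition_lattice n = \<lparr>carrier = partitions n, eq = (=), le = dominance n\<rparr>"

text \<open>
  Elements of \<^term>\<open>partitions n\<close> have length exactly \<open>n\<close>. A partition written with
  its trailing zeros omitted is turned into such a list by \<open>pad n\<close>. A list longer than \<open>n\<close>
  is left unchanged; this never loses a partition in the types below, since their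
  displayed entries other than a final \<open>0\<close> are positive.
\<close>

definition pad :: "nat \<Rightarrow> nat list \<Rightarrow> nat list" where
  "pad n xs = xs @ replicate (n - length xs) 0"

definition join_irreducibles :: "('a, 'b) gorder_scheme \<Rightarrow> 'a set" where
  "join_irreducibles L = {x \<in> carrier L. \<not> least L x (carrier L) \<and>
     (\<forall>y\<in>carrier L. \<forall>z\<in>carrier L. x = y \<squnion>\<^bsub>L\<^esub> z \<longrightarrow> x = y \<or> x = z)}"

definition meet_irreducibles :: "('a, 'b) gorder_scheme \<Rightarrow> 'a set" where
  "meet_irreducibles L = {x \<in> carrier L. \<not> greatest L x (carrier L) \<and>
     (\<forall>y\<in>carrier L. \<forall>z\<in>carrier L. x = y \<sqinter>\<^bsub>L\<^esub> z \<longrightarrow> x = y \<or> x = z)}"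

text \<open>The derivations \<open>g'\<close> and \<open>m'\<close> in the standard context
  \<open>(join_irreducibles L, meet_irreducibles L, \<sqsubseteq>)\<close>:\<close>

definition object_intent :: "('a, 'b) gorder_scheme \<Rightarrow> 'a \<Rightarrow> 'a set" where
  "object_intent L g = {y \<in> meet_irreducibles L. g \<sqsubseteq>\<^bsub>L\<^esub> y}"

definition attribute_extent :: "('a, 'b) gorder_scheme \<Rightarrow> 'a \<Rightarrow> 'a set" where
  "attribute_extent L m = {y \<in> join_irreducibles L. y \<sqsubseteq>\<^bsub>L\<^esub> m}"

text \<open>\<open>down_arrow L g m\<close> is \<open>g \<swarrow> m\<close> and \<open>up_arrow L g m\<close> is \<open>g \<nearrow> m\<close>, for join-irreducible
  \<open>g\<close> and meet-irreducible \<open>m\<close>.\<close>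

definition down_arrow :: "('a, 'b) gorder_scheme \<Rightarrow> 'a \<Rightarrow> 'a \<Rightarrow> bool" where
  "down_arrow L g m \<longleftrightarrow> \<not> g \<sqsubseteq>\<^bsub>L\<^esub> m \<and>
     (\<forall>h\<in>join_irreducibles L. object_intent L g \<subset> object_intent L h \<longrightarrow> h \<sqsubseteq>\<^bsub>L\<^esub> m)"

definition up_arrow :: "('a, 'b) gorder_scheme \<Rightarrow> 'a \<Rightarrow> 'a \<Rightarrow> bool" where
  "up_arrow L g m \<longleftrightarrow> \<not> g \<sqsubseteq>\<^bsub>L\<^esub> m \<and>
     (\<forall>y\<in>meet_irreducibles L. attribute_extent L m \<subset> attribute_extent L y \<longrightarrow> g \<sqsubseteq>\<^bsub>L\<^esub> y)"

definition type_I :: "nat \<Rightarrow> nat list \<Rightarrow> bool" where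
  "type_I n x \<longleftrightarrow> x \<in> partitions n \<and>
     (\<exists>t c. t \<ge> 1 \<and> c \<ge> 2 \<and> x = pad n (replicate c t))"

definition type_II :: "nat \<Rightarrow> nat list \<Rightarrow> bool" where
  "type_II n x \<longleftrightarrow> x \<in> partitions n \<and>
     (\<exists>t c r. t > r \<and> r \<ge> 1 \<and> c \<ge> 1 \<and> x = pad n (replicate c t @ [r]))"

definition type_IV :: "nat \<Rightarrow> nat list \<Rightarrow> bool" where
  "type_IV n x \<longleftrightarrow> x \<in> partitions n \<and>
     (\<exists>a t c r. a > t \<and> t > r \<and> t \<ge> 2 \<and> c \<ge> 2 \<and> x = pad n ([a] @ replicate c t @ [r]))"

definition type_D :: "nat \<Rightarrow> nat list \<Rightarrow> bool" where
  "type_D n x \<longleftrightarrow> x \<in> partitions n \<and>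
     (\<exists>b k l d. l \<ge> 1 \<and> d \<ge> 1 \<and> k \<ge> 3 \<and> b + l \<ge> 2 \<and>
       x = pad n (replicate b (k + 1) @ replicate l k @ replicate d 1))"

text \<open>This ensures that \<open>\<squnion>\<close> and \<open>\<sqinter>\<close>, which the library defines with a choice operator, are the
  actual join and meet.\<close>

lemma sum_take_Suc:
  fixes a :: "nat list"
  assumes "i < length a"
  shows "sum_list (take (Suc i) a) = sum_list (take i a) + a ! i"
  using assms by (simp add: take_Suc_conv_app_nth)

lemma dominance_alt:
  "dominance n a b \<longleftrightarrow> (\<forall>j\<le>n. sum_list (take j a) \<le> sum_list (take j b))"
proof -
  have "(j \<le> n) = (j = 0 \<or> j \<in> {1..n})" for j by auto
  then show ?thesis unfolding dominance_def by (metis order_refl take0)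
qed

lemma partial_order_partition_lattice: "partial_order (partition_lattice n)"
proof
  fix x y
  assume xy: "x \<sqsubseteq>\<^bsub>partition_lattice n\<^esub> y" "y \<sqsubseteq>\<^bsub>partition_lattice n\<^esub> x"
    "x \<in> carrier (partition_lattice n)" "y \<in> carrier (partition_lattice n)"
  then have len: "length x = n" "length y = n"
    by (auto simp: partition_lattice_def partitions_def)
  have S: "sum_list (take j x) = sum_list (take j y)" if "j \<le> n" for j
    using xy(1,2) that by (auto simp: partition_lattice_def dominance_alt intro: antisym)
  have "x = y"
  proof (rule nth_equalityI)
    fix i assume "i < length x"
    then show "x ! i = y ! i"
      using S[of i] S[of "Suc i"] sum_take_Suc[of i x] sum_take_Suc[of i y] len by simp
  qed (simp add: len)
  then show "x .=\<^bsub>partition_lattice n\<^esub> y" by (simp add: partition_lattice_def)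
qed (auto simp: partition_lattice_def dominance_def intro: order_trans)

lemma partition_lattice_inf_exists:
  assumes A: "A \<subseteq> carrier (partition_lattice n)" "A \<noteq> {}"
  shows "\<exists>i. greatest (partition_lattice n) i (Lower (partition_lattice n) A)"
proof -
  define P where "P x i = sum_list (take i x)" for x :: "nat list" and i
  define S where "S i = (LEAST s. \<exists>x\<in>A. s = P x i)" for i
  have AP: "length x = n" "sorted_wrt (\<ge>) x" "sum_list x = n" if "x \<in> A" for x
    using that A(1) by (auto simp: partition_lattice_def partitions_def)
  have S_le: "S i \<le> P x i" if "x \<in> A" for i x
    unfolding S_def using that by (auto intro: Least_le)
  have S_ex: "\<exists>x\<in>A. S i = P x i" for i
    unfolding S_def using A(2) by (rule_tac LeastI_ex) auto
  have S_n: "S n = n" and S_0: "S 0 = 0"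
    using S_ex[of n] S_ex[of 0] AP by (auto simp: P_def)
  have S_mono: "S i \<le> S (Suc i)" if "i < n" for i
  proof -
    obtain x where x: "x \<in> A" "S (Suc i) = P x (Suc i)" using S_ex by blast
    show ?thesis using S_le[OF x(1), of i] x sum_take_Suc[of i x] AP(1)[OF x(1)] that
      by (simp add: P_def)
  qed
  have S_conc: "S i + S (Suc (Suc i)) \<le> 2 * S (Suc i)" if "Suc i < n" for i
  proof -
    obtain x where x: "x \<in> A" "S (Suc i) = P x (Suc i)" using S_ex by blast
    have "x ! i \<ge> x ! Suc i" using AP[OF x(1)] that by (auto simp: sorted_wrt_iff_nth_less)
    then show ?thesis
      using S_le[OF x(1), of i] S_le[OF x(1), of "Suc (Suc i)"] x(2)
        sum_take_Suc[of i x] sum_take_Suc[of "Suc i" x] AP(1)[OF x(1)] that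
      by (simp add: P_def)
  qed
  define m where "m = map (\<lambda>i. S (Suc i) - S i) [0..<n]"
  have Pm: "P m i = S i" if "i \<le> n" for i
    using that
  proof (induction i)
    case (Suc i)
    then show ?case using sum_take_Suc[of i m] S_mono[of i] by (simp add: P_def m_def)
  qed (simp add: P_def S_0)
  have m_part: "m \<in> partitions n"
  proof -
    have "m ! j \<le> m ! i" if "i < j" "j < n" for i j
      using that
    proof (induction rule: strict_inc_induct)
      case (base i)
      then show ?case using S_conc[of i] S_mono[of i] by (auto simp: m_def)
    next
      case (step i)
      then have "m ! Suc i \<le> m ! i" using S_conc[of i] S_mono[of i] by (auto simp: m_def)
      with step show ?case by simp
    qed
    moreover have "sum_list m = n" using Pm[of n] S_n by (simp add: P_def m_def)
    ultimately show ?thesis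
      by (auto simp: partitions_def sorted_wrt_iff_nth_less m_def)
  qed
  have "greatest (partition_lattice n) m (Lower (partition_lattice n) A)"
  proof (rule greatest_LowerI)
    show "m \<sqsubseteq>\<^bsub>partition_lattice n\<^esub> x" if "x \<in> A" for x
      using Pm S_le[OF that] by (simp add: partition_lattice_def dominance_alt P_def)
    show "y \<sqsubseteq>\<^bsub>partition_lattice n\<^esub> m" if "y \<in> Lower (partition_lattice n) A" for y
    proof -
      have "P y j \<le> P m j" if j: "j \<le> n" for j
      proof -
        obtain x where x: "x \<in> A" "S j = P x j" using S_ex by blast
        then have "y \<sqsubseteq>\<^bsub>partition_lattice n\<^esub> x"
          using \<open>y \<in> Lower _ _\<close> A(1) by blast
        then show ?thesis
          using x j Pm by (simp add: partition_lattice_def dominance_alt P_def)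
      qed
      then show ?thesis by (simp add: partition_lattice_def dominance_alt P_def)
    qed
  qed (use A(1) m_part in \<open>auto simp: partition_lattice_def\<close>)
  then show ?thesis ..
qed

lemma partition_lattice_top_exists:
  "\<exists>g. greatest (partition_lattice n) g (carrier (partition_lattice n))"
proof (cases n)
  case 0
  then have "greatest (partition_lattice n) [] (carrier (partition_lattice n))"
    by (auto simp: greatest_def partition_lattice_def partitions_def dominance_def)
  then show ?thesis ..
next
  case (Suc k)
  have "sum_list (take j x) \<le> Suc k" if "x \<in> partitions n" for j x
  proof -
    have "sum_list x = sum_list (take j x) + sum_list (drop j x)"
      by (metis append_take_drop_id sum_list_append)
    then show ?thesis using that Suc by (simp add: partitions_def)
  qed
  then have "greatest (partition_lattice n) (n # replicate k 0) (carrier (partition_lattice n))"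
    using Suc by (auto simp: greatest_def partition_lattice_def partitions_def dominance_def
        sorted_wrt_iff_nth_less nth_Cons' take_Cons' sum_list_replicate)
  then show ?thesis ..
qed

theorem complete_lattice_partition_lattice: "complete_lattice (partition_lattice n)"
  by (intro partial_order.complete_lattice_criterion1 partial_order_partition_lattice
      partition_lattice_top_exists partition_lattice_inf_exists)

end

(* Both arrows reduce to properties of the covers of p and q. Every partition y > q dominates p: the
   partial sums of q are affine on {1..k}, so concavity of the partial sums of y makes y exceed q by
   at least 1 wherever p does. Hence q is meet-irreducible and p \<nearrow> q. Dually, replacing the
   adjacent entries \<kappa>, 1 of p by \<kappa> - 1, 2 gives a partition r that dominates every y < p,
   so p is join-irreducible. Since r still exceeds q at the partial sum of length d + 1 < t, a
   join-irreducible element below r but not below q refutes p \<swarrow> q. *)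

theory Submission
  imports Defs
begin

section \<open>Irreducible elements and arrows in a lattice\<close>

context lattice
begin

text \<open>The element \<open>m\<close> bounds everything strictly below \<open>x\<close>, so the
  join of two such elements stays below \<open>m\<close> and cannot equal \<open>x\<close>.\<close>

lemma join_irreduciblesI:
  assumes x: "x \<in> carrier L" and m: "m \<in> carrier L" and nle: "\<not> x \<sqsubseteq> m"
    and below: "\<And>y. y \<in> carrier L \<Longrightarrow> y \<sqsubseteq> x \<Longrightarrow> y \<noteq> x \<Longrightarrow> y \<sqsubseteq> m"
  shows "x \<in> join_irreducibles L"
proof -
  have "\<not> least L x (carrier L)"
    using m nle by (auto dest: least_le)
  moreover have "x = y \<or> x = z" if "y \<in> carrier L" "z \<in> carrier L" "x = y \<squnion> z" for y z
  proof (rule ccontr)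
    assume "\<not> (x = y \<or> x = z)"
    then have "y \<sqsubseteq> m" "z \<sqsubseteq> m"
      using below join_left join_right that by metis+
    then show False
      using join_le m nle that by metis
  qed
  ultimately show ?thesis
    using x by (simp add: join_irreducibles_def)
qed

text \<open>An element \<open>h\<close> minimal among those below \<open>x\<close> but not below
  \<open>y\<close> is join-irreducible: everything strictly below it lies below \<open>y\<close>, so
  \<open>y\<close> takes the role of \<open>m\<close> in \<open>join_irreduciblesI\<close>.\<close>

lemma join_irreducible_separates:
  assumes fin: "finite (carrier L)"
    and xy: "x \<in> carrier L" "y \<in> carrier L" "\<not> x \<sqsubseteq> y"
  obtains h where "h \<in> join_irreducibles L" "h \<sqsubseteq> x" "\<not> h \<sqsubseteq> y"
proof -
  \<comment> \<open>Minimality is measured by the size of the principal ideal \<open>B u\<close>,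
    which shrinks strictly on passing to a smaller element because the carrier is finite.\<close>
  define B where "B u = {v \<in> carrier L. v \<sqsubseteq> u}" for u
  define h where "h = arg_min (\<lambda>u. card (B u)) (\<lambda>u. u \<in> carrier L \<and> u \<sqsubseteq> x \<and> \<not> u \<sqsubseteq> y)"
  have ex: "x \<in> carrier L \<and> x \<sqsubseteq> x \<and> \<not> x \<sqsubseteq> y"
    using xy by simp
  have h: "h \<in> carrier L" "h \<sqsubseteq> x" "\<not> h \<sqsubseteq> y"
    using arg_min_natI[of "\<lambda>u. u \<in> carrier L \<and> u \<sqsubseteq> x \<and> \<not> u \<sqsubseteq> y", OF ex] by (auto simp: h_def)
  have "u \<sqsubseteq> y" if u: "u \<in> carrier L" "u \<sqsubseteq> h" "u \<noteq> h" for u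
  proof (rule ccontr)
    assume "\<not> u \<sqsubseteq> y"
    then have "card (B h) \<le> card (B u)"
      unfolding h_def using u h le_trans[of u h x] xy
      by (intro arg_min_nat_le) (auto simp: h_def)
    moreover have "B u \<subseteq> B h"
      using u h by (auto simp: B_def intro: le_trans)
    moreover have "h \<in> B h - B u"
      using u h le_antisym[of u h] eq_is_equal by (auto simp: B_def)
    moreover have "finite (B h)"
      using fin by (simp add: B_def)
    ultimately show False
      by (metis DiffD1 DiffD2 card_seteq)
  qed
  then have "h \<in> join_irreducibles L"
    using h xy by (intro join_irreduciblesI[of h y]) auto
  then show thesis
    using that h by blast
qed

lemma meet_irreducibles_dual: "meet_irreducibles L = join_irreducibles (inv_gorder L)"
  by (simp add: meet_irreducibles_def join_irreducibles_def)

lemma meet_irreduciblesI: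
  assumes "x \<in> carrier L" "m \<in> carrier L" "\<not> m \<sqsubseteq> x"
    and "\<And>y. y \<in> carrier L \<Longrightarrow> x \<sqsubseteq> y \<Longrightarrow> y \<noteq> x \<Longrightarrow> m \<sqsubseteq> y"
  shows "x \<in> meet_irreducibles L"
  unfolding meet_irreducibles_dual
  using assms by (intro lattice.join_irreduciblesI[OF dual_lattice, of x m]) auto

lemma meet_irreducible_separates:
  assumes "finite (carrier L)" "x \<in> carrier L" "y \<in> carrier L" "\<not> x \<sqsubseteq> y"
  obtains m where "m \<in> meet_irreducibles L" "y \<sqsubseteq> m" "\<not> x \<sqsubseteq> m"
  using lattice.join_irreducible_separates[OF dual_lattice, of y x] assms
  unfolding meet_irreducibles_dual by auto

text \<open>Join-irreducibles separate elements, so inclusion of extents forces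
  \<open>q \<sqsubseteq> y\<close>; strictness excludes \<open>y = q\<close>, and
  \<open>above\<close> applies.\<close>

lemma up_arrowI:
  assumes fin: "finite (carrier L)" and q: "q \<in> carrier L" and nle: "\<not> p \<sqsubseteq> q"
    and above: "\<And>y. y \<in> carrier L \<Longrightarrow> q \<sqsubseteq> y \<Longrightarrow> y \<noteq> q \<Longrightarrow> p \<sqsubseteq> y"
  shows "up_arrow L p q"
  unfolding up_arrow_def
proof (intro conjI ballI impI nle)
  fix y assume y: "y \<in> meet_irreducibles L" "attribute_extent L q \<subset> attribute_extent L y"
  then have yL: "y \<in> carrier L"
    by (simp add: meet_irreducibles_def)
  have "q \<sqsubseteq> y"
  proof (rule ccontr)
    assume "\<not> q \<sqsubseteq> y"
    then obtain h where "h \<in> join_irreducibles L" "h \<sqsubseteq> q" "\<not> h \<sqsubseteq> y"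
      using join_irreducible_separates[OF fin q yL] by blast
    then show False
      using y(2) by (auto simp: attribute_extent_def)
  qed
  then show "p \<sqsubseteq> y"
    using above yL y(2) by blast
qed

text \<open>A join-irreducible \<open>h\<close> below \<open>x\<close> but not below
  \<open>q\<close> violates the arrow, once its intent is known to contain that of \<open>p\<close>
  strictly.\<close>

lemma not_down_arrowI:
  assumes fin: "finite (carrier L)"
    and p: "p \<in> carrier L" and q: "q \<in> carrier L" and x: "x \<in> carrier L"
    and xp: "x \<sqsubseteq> p" "x \<noteq> p" and xq: "\<not> x \<sqsubseteq> q"
  shows "\<not> down_arrow L p q"
proof
  assume down: "down_arrow L p q"
  obtain h where h: "h \<in> join_irreducibles L" "h \<sqsubseteq> x" "\<not> h \<sqsubseteq> q"
    using join_irreducible_separates[OF fin x q xq] .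
  have hL: "h \<in> carrier L"
    using h by (simp add: join_irreducibles_def)
  \<comment> \<open>A meet-irreducible above \<open>x\<close> but not above \<open>p\<close> lies in
    the intent of \<open>h\<close> only and makes the inclusion strict.\<close>
  have "\<not> p \<sqsubseteq> x"
    using xp p x le_antisym eq_is_equal by blast
  then obtain m where m: "m \<in> meet_irreducibles L" "x \<sqsubseteq> m" "\<not> p \<sqsubseteq> m"
    using meet_irreducible_separates[OF fin p x] by blast
  have mL: "y \<in> carrier L" if "y \<in> meet_irreducibles L" for y
    using that by (simp add: meet_irreducibles_def)
  have "object_intent L p \<subset> object_intent L h"
  proof
    have "h \<sqsubseteq> p"
      using h xp hL p x le_trans by blast
    then show "object_intent L p \<subseteq> object_intent L h"
      using mL hL p by (auto simp: object_intent_def intro: le_trans)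
    have "m \<in> object_intent L h" "m \<notin> object_intent L p"
      using m h hL x mL by (auto simp: object_intent_def intro: le_trans)
    then show "object_intent L p \<noteq> object_intent L h"
      by blast
  qed
  then show False
    using down h by (auto simp: down_arrow_def)
qed

end

section \<open>Partial sums of partitions and the dominance order\<close>

abbreviation psum :: "nat list \<Rightarrow> nat \<Rightarrow> nat" where
  "psum x j \<equiv> sum_list (take j x)"

lemma finite_partitions: "finite (partitions n)"
proof (rule finite_subset)
  show "partitions n \<subseteq> {xs. set xs \<subseteq> {..n} \<and> length xs = n}"
    using member_le_sum_list by (fastforce simp: partitions_def)
qed (simp add: finite_lists_length_eq)

lemma not_dominanceI:
  assumes "psum y j < psum x j" "j \<le> n"
  shows "\<not> dominance n x y"
  using assms by (auto simp: dominance_alt not_le)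

lemma partitions_eqI:
  assumes "x \<in> partitions n" "y \<in> partitions n" "\<And>j. j \<le> n \<Longrightarrow> psum x j = psum y j"
  shows "x = y"
proof -
  interpret partial_order "partition_lattice n"
    by (rule partial_order_partition_lattice)
  show ?thesis
    using le_antisym[of x y] eq_is_equal assms
    by (simp add: partition_lattice_def dominance_alt)
qed

lemma psum_le: "psum x j \<le> sum_list x" for x :: "nat list"
  by (metis append_take_drop_id le_add1 sum_list_append)

text \<open>Concavity of the partial sums: the entry \<open>x ! j\<close> following the first
  \<open>j\<close> entries is the slope of a supporting line at \<open>j\<close>, since earlier
  entries are at least as large and later ones at most as large.\<close>

lemma partition_supergradient:
  assumes x: "x \<in> partitions n" and j: "j < n"
  obtains c :: int where "c \<ge> 0"
    "\<And>i. i \<le> n \<Longrightarrow> int (psum x i) \<le> int (psum x j) + (int i - int j) * c"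
proof (rule that[of "int (x ! j)"])
  fix i assume "i \<le> n"
  have len: "length x = n" and mono: "\<And>u v. u \<le> v \<Longrightarrow> v < n \<Longrightarrow> x ! v \<le> x ! u"
    using x by (auto simp: partitions_def sorted_wrt_iff_nth_less le_less)
  show "int (psum x i) \<le> int (psum x j) + (int i - int j) * int (x ! j)"
  proof (cases "i \<le> j")
    case True
    then show ?thesis
    proof (induction rule: inc_induct)
      case (step m)
      then show ?case
        using sum_take_Suc[of m x] mono[of m j] j len by (simp add: algebra_simps)
    qed simp
  next
    case False
    then have "j \<le> i" by simp
    then show ?thesis using \<open>i \<le> n\<close>
    proof (induction rule: dec_induct)
      case (step m)
      then show ?case
        using sum_take_Suc[of m x] mono[of j m] j len by (simp add: algebra_simps)
    qed simp
  qed
qed simp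

lemma psum_pad [simp]: "psum (pad n xs) j = psum xs j"
  by (simp add: pad_def sum_list_replicate)

lemma psum_append: "psum (xs @ ys) j = psum xs j + psum ys (j - length xs)"
  by simp

lemma psum_replicate: "psum (replicate m c) j = min j m * c"
  by (simp add: sum_list_replicate min.commute)

lemma sorted_wrt_ge_replicate [simp]: "sorted_wrt (\<ge>) (replicate m (x :: nat))"
  by (induction m) auto

lemma pad_snoc_0:
  assumes "length xs < n"
  shows "pad n (xs @ [0]) = pad n xs"
  using assms by (simp add: pad_def Suc_diff_Suc flip: replicate_Suc)

lemma pad_in_partitions:
  assumes "sorted_wrt (\<ge>) xs" "sum_list xs = n" "length xs \<le> n"
  shows "pad n xs \<in> partitions n"
  using assms by (auto simp: partitions_def pad_def sorted_wrt_append sum_list_replicate)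

text \<open>Suppose \<open>y\<close> meets \<open>q\<close> at \<open>j\<close>. A supporting line
  of \<open>y\<close> at \<open>j\<close> must stay above \<open>q\<close> on both sides of
  \<open>j\<close>, which forces its slope to be \<kappa>. Then it is the line carrying
  \<open>q\<close> on \<open>{1..k}\<close>, so \<open>y\<close> and \<open>q\<close> agree there;
  beyond \<open>k\<close> both have reached \<open>n\<close>.\<close>

lemma psum_strict_above:
  assumes q: "q \<in> partitions n" and y: "y \<in> partitions n" and le: "dominance n q y" and ne: "y \<noteq> q"
    and kn: "k \<le> n"
    and mid: "\<And>i. 1 \<le> i \<Longrightarrow> i \<le> k \<Longrightarrow> psum q i = i * \<kappa> + d"
    and tail: "\<And>i. k < i \<Longrightarrow> i \<le> n \<Longrightarrow> psum q i = n"
    and j: "1 \<le> j" "j < k" "j = 1 \<Longrightarrow> d = 0"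
  shows "psum q j < psum y j"
proof (rule ccontr)
  assume "\<not> psum q j < psum y j"
  moreover have ge: "psum q i \<le> psum y i" if "i \<le> n" for i
    using le that by (simp add: dominance_alt)
  ultimately have yj: "psum y j = j * \<kappa> + d"
    using ge[of j] mid[of j] j kn by linarith
  obtain c where c: "\<And>i. i \<le> n \<Longrightarrow> int (psum y i) \<le> int (j * \<kappa> + d) + (int i - int j) * c"
    using partition_supergradient[OF y, of j] j kn yj by (metis le_trans linorder_not_le)
  have "c \<le> int \<kappa>"
  \<comment> \<open>At \<open>j = 1\<close> no index of \<open>{1..k}\<close> lies to the left. The
    index \<open>0\<close> replaces it: the affine formula extends there because
    \<open>d = 0\<close>.\<close>
  proof (cases "j = 1")
    case True
    then show ?thesis
      using c[of 0] j by simp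
  next
    case False
    have "(int j - 1) * c \<le> (int j - 1) * int \<kappa>"
      using c[of 1] ge[of 1] mid[of 1] j kn by (simp add: algebra_simps)
    then show ?thesis
      using False j by simp
  qed
  moreover have "int (k * \<kappa> + d) \<le> int (psum y k)"
    unfolding of_nat_le_iff using ge[of k] mid[of k] j kn by simp
  then have "(int k - int j) * int \<kappa> \<le> (int k - int j) * c"
    using c[of k] kn by (simp add: algebra_simps)
  then have "int \<kappa> \<le> c"
    using j by simp
  ultimately have c_eq: "c = int \<kappa>"
    by simp
  have "psum y i = psum q i" if i: "i \<le> n" for i
  proof -
    consider "i = 0" | "1 \<le> i" "i \<le> k" | "k < i"
      by linarith
    then show ?thesis
    proof cases
      case 2
      have "int (psum y i) \<le> int (i * \<kappa> + d)"
        using c[OF i] by (simp add: c_eq algebra_simps)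
      then show ?thesis
        using mid[OF 2] ge[OF i] by linarith
    next
      case 3
      then show ?thesis
        using tail[of i] ge[OF i] psum_le[of i y] y i by (simp add: partitions_def)
    qed simp
  qed
  then show False
    using partitions_eqI[OF y q] ne by blast
qed

text \<open>If \<open>y\<close> meets \<open>p\<close> at \<open>t\<close>, then it equals
  \<open>p\<close>: at an index \<open>j\<close> where \<open>y\<close> is smaller, no integer slope
  of a supporting line fits the values of \<open>y\<close> at \<open>0\<close>, \<open>t\<close> and
  \<open>n\<close>.\<close>

lemma psum_strict_below:
  assumes p: "p \<in> partitions n" and y: "y \<in> partitions n" and le: "dominance n y p" and ne: "y \<noteq> p"
    and tn: "t < n"
    and top: "psum p t = t * \<kappa> + e"
    and init1: "\<And>i. i \<le> t \<Longrightarrow> psum p i \<le> i * (\<kappa> + 1)"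
    and init2: "\<And>i. i \<le> t \<Longrightarrow> psum p i \<le> i * \<kappa> + e"
    and tail: "\<And>i. t \<le> i \<Longrightarrow> psum p i \<le> psum p t + (i - t)"
  shows "psum y t < psum p t"
proof (rule ccontr)
  assume "\<not> psum y t < psum p t"
  moreover have "psum y i \<le> psum p i" if "i \<le> n" for i
    using le that by (simp add: dominance_alt)
  ultimately have yt: "psum y t = psum p t"
    using tn by (simp add: le_antisym)
  have "psum y j = psum p j" if j: "j \<le> n" for j
  proof (rule ccontr)
    assume "psum y j \<noteq> psum p j"
    then have less: "psum y j < psum p j"
      using le j by (force simp: dominance_alt)
    have "psum p j \<le> n"
      using psum_le[of j p] p by (simp add: partitions_def)
    have "j < n"
      using less \<open>psum p j \<le> n\<close> j y by (cases "j = n") (auto simp: partitions_def)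
    then obtain c :: int where c: "c \<ge> 0"
      "\<And>i. i \<le> n \<Longrightarrow> int (psum y i) \<le> int (psum y j) + (int i - int j) * c"
      using partition_supergradient[OF y] by metis
    show False
    proof (cases "j \<le> t")
      case True
      show False
      \<comment> \<open>By integrality the slope is at most \<kappa> or at least
        \<open>\<kappa> + 1\<close>. The former is refuted at \<open>t\<close> with
        \<open>init2\<close>, the latter at \<open>0\<close> with \<open>init1\<close>.\<close>
      proof (cases "c \<le> int \<kappa>")
        case True
        have "(int t - int j) * c \<le> (int t - int j) * int \<kappa>"
          using True \<open>j \<le> t\<close> by (intro mult_left_mono) auto
        then have "int (t * \<kappa> + e) \<le> int (psum y j) + (int t - int j) * int \<kappa>"
          using c(2)[of t] tn yt top by linarith
        then have "int (j * \<kappa> + e) \<le> int (psum y j)"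
          by (simp add: algebra_simps)
        then show False
          using init2[OF \<open>j \<le> t\<close>] less by linarith
      next
        case False
        have "int j * int (\<kappa> + 1) \<le> int j * c"
          using False by (intro mult_left_mono) auto
        then have "int (j * (\<kappa> + 1)) \<le> int (psum y j)"
          using c(2)[of 0] by (simp add: algebra_simps)
        then show False
          using init1[OF \<open>j \<le> t\<close>] less by linarith
      qed
    next
      case False
      \<comment> \<open>From \<open>t\<close> to \<open>j\<close> the sums of \<open>y\<close> grow
        by less than \<open>j - t\<close>, so the slope at \<open>j\<close> is \<open>0\<close>.
        Then \<open>y\<close> never rises above \<open>psum y j < n\<close>, although its total is
        \<open>n\<close>.\<close>
      then have "(int j - int t) * c < (int j - int t) * 1"
        using c(2)[of t] tn yt tail[of j] less by (simp add: algebra_simps)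
      then have "c = 0"
        using c(1) False by (simp add: mult_less_cancel_left)
      then show False
        using c(2)[of n] y less \<open>psum p j \<le> n\<close> by (simp add: partitions_def)
    qed
  qed
  then show False
    using partitions_eqI[OF y p] ne by blast
qed

section \<open>The arrows between \<open>p\<close> and \<open>q\<close>\<close>

theorem corollary5p8:
  fixes b d k l t n a \<kappa> :: nat and p q :: "nat list"
  assumes "k \<ge> 1" and "l \<ge> 1" and "t \<ge> 1"
    and "b + l \<ge> 3" and "k \<ge> d + 3" and "d + 1 < t" and "t \<le> k - 1"
    and "n = b * (k + 1) + l * k + d"
    and "a = b + (b + l) * (k - t) + t - 1"
    and "\<kappa> = b + l"
    and "p = pad n (replicate (d + 1) (\<kappa> + 1) @ replicate (t - d - 1) \<kappa> @ replicate (a - t) 1)"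
    and "q = pad n ([\<kappa> + d] @ replicate (k - 1) \<kappa> @ [b])"
  shows "a \<ge> t + 2
    \<and> p \<in> join_irreducibles (partition_lattice n) \<and> type_D n p
    \<and> q \<in> meet_irreducibles (partition_lattice n)
    \<and> (b = 0 \<and> d = 0 \<longrightarrow> type_I n q)
    \<and> (d = 0 \<and> b \<ge> 1 \<longrightarrow> type_II n q)
    \<and> (d \<ge> 1 \<longrightarrow> type_IV n q)
    \<and> up_arrow (partition_lattice n) p q
    \<and> \<not> down_arrow (partition_lattice n) p q"
proof -
  \<comment> \<open>The offsets \<open>u\<close>, \<open>v\<close> and, below, \<open>w\<close> turn
    the truncated subtractions into sums: \<open>t = d + 2 + u\<close>,
    \<open>k = t + 1 + v\<close>, \<open>a = t + 2 + w\<close>.\<close>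
  define u where "u = t - d - 2"
  define v where "v = k - t - 1"
  have t: "t = d + 2 + u" and k: "k = t + 1 + v"
    using assms by (auto simp: u_def v_def)
  have l: "\<kappa> = b + l" "1 \<le> l" "3 \<le> \<kappa>"
    using assms by auto
  define w where "w = a - t - 2"
  have at: "a - t = b + \<kappa> * (k - t) - 1"
    using assms by simp
  \<comment> \<open>Since \<open>t < k\<close>, this gives
    \<open>a - t \<ge> \<kappa> - 1 \<ge> 2\<close>.\<close>
  have "\<kappa> \<le> \<kappa> * (k - t)"
    using k by simp
  then have a: "a = t + 2 + w" "w + 3 = b + \<kappa> * (v + 1)"
    using at assms(4,10) k unfolding w_def by simp_all
  \<comment> \<open>The two forms of \<open>n\<close> are the entry sums of \<open>q\<close> and of
    \<open>p\<close>.\<close>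
  have n: "n = k * \<kappa> + d + b"
    using assms(8) l by (simp add: algebra_simps)
  then have n': "n = t * \<kappa> + d + 3 + w"
    using a(2) k by (simp add: algebra_simps)
  \<comment> \<open>With \<kappa> at least 3, the \<open>k + 1\<close> displayed entries of
    \<open>q\<close> and the \<open>t + w + 2\<close> entries of \<open>p\<close> and
    \<open>r\<close> fit into length \<open>n\<close>.\<close>
  have "k * 3 \<le> k * \<kappa>" "t * 3 \<le> t * \<kappa>"
    using l by simp_all
  then have kn: "k + 1 \<le> n" and tn: "t + w + 2 \<le> n"
    using n n' k by linarith+

  \<comment> \<open>One unit moves from position \<open>t\<close> to position \<open>t + 1\<close>
    of \<open>p\<close>, so the partial sums change only at \<open>t\<close>, where they drop by
    one. The list stays sorted because \<open>\<kappa> - 1 \<ge> 2\<close>.\<close>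
  define r where "r = pad n (replicate (d + 1) (\<kappa> + 1) @ replicate u \<kappa> @ [\<kappa> - 1, 2] @ replicate (w + 1) 1)"
  have p_eq: "p = pad n (replicate (d + 1) (\<kappa> + 1) @ replicate (u + 1) \<kappa> @ replicate (w + 2) 1)"
    using assms(11) t a by simp
  have pP: "p \<in> partitions n"
    unfolding p_eq using l n' tn t
    by (intro pad_in_partitions) (auto simp: sorted_wrt_append sum_list_replicate algebra_simps)
  have rP: "r \<in> partitions n"
    unfolding r_def using l n' tn t
    by (intro pad_in_partitions) (auto simp: sorted_wrt_append sum_list_replicate algebra_simps)
  have qP: "q \<in> partitions n"
    unfolding assms(12) using l n k kn
    by (intro pad_in_partitions) (auto simp: sorted_wrt_append sum_list_replicate algebra_simps)

  \<comment> \<open>Partial sums of \<open>p\<close>, \<open>r\<close> and \<open>q\<close>\<close>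
  note psum_simps = psum_pad psum_append psum_replicate length_replicate
  have p_init: "psum p j = j * (\<kappa> + 1)" if "j \<le> d + 1" for j
    using that unfolding p_eq psum_simps by simp
  have p_mid: "psum p j = j * \<kappa> + (d + 1)" if "d + 1 \<le> j" "j \<le> t" for j
  proof -
    define i where "i = j - (d + 1)"
    have i: "j = i + (d + 1)" "i \<le> u + 1"
      using that t by (auto simp: i_def)
    show ?thesis
      unfolding p_eq psum_simps i(1) using i(2) by (simp add: algebra_simps)
  qed
  have p_tail: "psum p j = t * \<kappa> + (d + 1) + min (j - t) (w + 2)" if "t \<le> j" for j
  proof -
    define i where "i = j - t"
    have i: "j = i + u + 1 + (d + 1)"
      using that t by (auto simp: i_def)
    show ?thesis
      unfolding p_eq psum_simps i t by (simp add: algebra_simps)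
  qed
  have r_less: "psum r j = psum p j" if "j < t" for j
    using that t unfolding p_eq r_def psum_simps by simp
  have r_at: "psum r t = t * \<kappa> + d"
    using l(3) unfolding r_def psum_simps t by (simp add: algebra_simps)
  have r_greater: "psum r j = psum p j" if "t < j" for j
  proof -
    define i where "i = j - t - 1"
    have i: "j = i + u + 2 + (d + 1)"
      using that t by (auto simp: i_def)
    show ?thesis
      unfolding p_eq r_def psum_simps i using l(3) by (simp add: algebra_simps)
  qed
  have q_init: "psum q j = j * \<kappa> + d" if "1 \<le> j" "j \<le> k" for j
    using that unfolding assms(12) psum_simps by (cases j) simp_all
  have q_tail: "psum q j = n" if "k < j" for j
    using that k unfolding assms(12) psum_simps by (simp add: n take_Cons')

  \<comment> \<open>Comparisons in the dominance order\<close>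
  interpret complete_lattice "partition_lattice n"
    by (rule complete_lattice_partition_lattice)
  let ?L = "partition_lattice n"
  have L: "carrier ?L = partitions n" "le ?L = dominance n" and fin: "finite (carrier ?L)"
    by (simp_all add: partition_lattice_def finite_partitions)

  have pq: "\<not> dominance n p q"
    using p_mid[of t] q_init[of t] t k kn by (intro not_dominanceI[where j = t]) auto
  have pr: "\<not> dominance n p r"
    using p_mid[of t] r_at t k kn by (intro not_dominanceI[where j = t]) auto
  have "psum r j \<le> psum p j" for j
    using r_less[of j] r_greater[of j] r_at p_mid[of t] t
    by (cases j t rule: linorder_cases) simp_all
  then have rp: "dominance n r p"
    by (simp add: dominance_alt)
  have rq: "\<not> dominance n r q"
    using p_mid[of "d + 1"] q_init[of "d + 1"] r_less[of "d + 1"] t k kn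
    by (intro not_dominanceI[where j = "d + 1"]) auto

  have above: "dominance n p y" if y: "y \<in> partitions n" "dominance n q y" "y \<noteq> q" for y
    unfolding dominance_alt
  proof (intro allI impI)
    fix j assume j: "j \<le> n"
    have qy: "psum q j \<le> psum y j"
      using y(2) j by (simp add: dominance_alt)
    \<comment> \<open>Up to \<open>d\<close> the sums of \<open>p\<close> do not exceed those of
      \<open>q\<close>, and from \<open>d + 1\<close> to \<open>t\<close> they exceed them by
      exactly one. Past \<open>t\<close>, \<open>q\<close> gains \<kappa> per step and
      \<open>p\<close> at most one, so \<open>q\<close> catches up at once; past \<open>k\<close>,
      \<open>q\<close> has reached \<open>n\<close>.\<close>
    consider "j = 0" | "1 \<le> j" "j \<le> d" | "d + 1 \<le> j" "j \<le> t" | "t < j" "j \<le> k" | "k < j"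
      by linarith
    then show "psum p j \<le> psum y j"
    proof cases
      case 2
      then show ?thesis
        using p_init[of j] q_init[of j] qy t k by simp
    next
      case 3
      \<comment> \<open>Here \<open>d + 1 \<le> j\<close>, so \<open>j = 1\<close> indeed implies
        \<open>d = 0\<close>, and \<open>t < k\<close> gives \<open>j < k\<close>.\<close>
      have "psum q j < psum y j"
        using psum_strict_above[OF qP y, of k \<kappa> d j] kn q_init q_tail 3 k by auto
      then show ?thesis
        using p_mid[OF 3] q_init[of j] 3 k by simp
    next
      case 4
      have "(j - t) * 2 \<le> (j - t) * \<kappa>"
        using l(3) by (intro mult_le_mono2) simp
      moreover have "j * \<kappa> = t * \<kappa> + (j - t) * \<kappa>"
        using 4 by (simp flip: add_mult_distrib)
      moreover have "psum p j \<le> t * \<kappa> + (d + 1) + (j - t)"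
        using p_tail[of j] 4 by simp
      moreover have "psum q j = j * \<kappa> + d"
        using q_init[of j] 4 by simp
      ultimately show ?thesis
        using qy 4(1) by linarith
    next
      case 5
      then show ?thesis
        using q_tail[of j] qy psum_le[of j p] pP by (simp add: partitions_def)
    qed simp
  qed

  have below: "dominance n y r" if y: "y \<in> partitions n" "dominance n y p" "y \<noteq> p" for y
  proof -
    \<comment> \<open>Strictness at \<open>t\<close> suffices, the only index where \<open>r\<close>
      differs from \<open>p\<close>.\<close>
    have "psum y t < psum p t"
    proof (rule psum_strict_below[OF pP y, of t \<kappa> "d + 1"])
      show "psum p i \<le> i * (\<kappa> + 1)" "psum p i \<le> i * \<kappa> + (d + 1)" if "i \<le> t" for i
        using p_init[of i] p_mid[of i] that by (cases "i \<le> d + 1"; simp)+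
    qed (use tn p_mid[of t] p_tail t in auto)
    then have "psum y j \<le> psum r j" if "j \<le> n" for j
      using y(2) that r_less[of j] r_greater[of j] r_at p_mid[of t] t
      by (cases j t rule: linorder_cases) (auto simp: dominance_alt)
    then show ?thesis
      by (simp add: dominance_alt)
  qed

  \<comment> \<open>Irreducibility, arrows and types\<close>
  have "p \<in> join_irreducibles ?L"
    using join_irreduciblesI[of p r] pP rP pr below by (simp add: L)
  moreover have "q \<in> meet_irreducibles ?L"
    using meet_irreduciblesI[of q p] pP qP pq above by (simp add: L)
  moreover have "up_arrow ?L p q"
    using up_arrowI[OF fin, of q p] qP pq above by (simp add: L)
  moreover have "\<not> down_arrow ?L p q"
    using not_down_arrowI[OF fin, of p q r] pP qP rP rp rq pr by (auto simp: L dominance_def)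
  moreover have "type_D n p"
    unfolding type_D_def
    by (rule conjI[OF pP], rule exI[of _ "d + 1"], rule exI[of _ \<kappa>], rule exI[of _ "u + 1"],
        rule exI[of _ "w + 2"]) (use p_eq l(3) in simp)
  moreover have "type_I n q" if "b = 0" "d = 0"
  proof -
    \<comment> \<open>For \<open>d = 0\<close> the first entry joins the block of \<kappa>; the
      final entry \<open>b = 0\<close> is then absorbed by the padding.\<close>
    have "q = pad n (replicate k \<kappa> @ [0])"
      unfolding assms(12) using that k by simp
    then have *: "q = pad n (replicate k \<kappa>)"
      using kn by (simp only: pad_snoc_0 length_replicate)
    show ?thesis
      unfolding type_I_def
      by (rule conjI[OF qP], rule exI[of _ \<kappa>], rule exI[of _ k]) (use * l k t in simp)
  qed
  moreover have "type_II n q" if "d = 0" "b \<ge> 1"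
    unfolding type_II_def
    by (rule conjI[OF qP], rule exI[of _ \<kappa>], rule exI[of _ k], rule exI[of _ b])
      (use l k that assms(12) in simp)
  \<comment> \<open>The last entry \<open>b\<close> may be \<open>0\<close> here, and
    \<open>b < \<kappa>\<close> holds because \<open>l \<ge> 1\<close>.\<close>
  moreover have "type_IV n q" if "d \<ge> 1"
    unfolding type_IV_def
    by (rule conjI[OF qP], rule exI[of _ "\<kappa> + d"], rule exI[of _ \<kappa>], rule exI[of _ "k - 1"],
        rule exI[of _ b]) (use l k t that assms(12) in simp)
  ultimately show ?thesis
    using a(1) by simp
qed

end
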